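(* Let $G$ be an ample Hausdorff groupoid and let $\mathbb{F}$ be a field. Suppose that $G$ is strongly effective. Then $$U \mapsto I_U:=\{f \in A_{\mathbb{F}}(G) : \operatorname{supp} f \subseteq G_U\}$$ is an isomorphism from the lattice of open invariant subsets of $G^{(0)}$ onto the lattice of ideals of $A_{\mathbb{F}}(G)$.
   Context: Groupoids. $G$ is a topological groupoid with unit space $G^{(0)}$ and range and source maps $r,s:G\to G^{(0)}$. An open bisection is an open set $B\subseteq G$ such that $r$ and $s$ restrict to homeomorphisms of $B$ onto open subsets of $G^{(0)}$. $G$ is ample if it has a basis of compact open bisections. The isotropy is $\operatorname{Iso}(G)=\{\gamma\in G: r(\gamma)=s(\gamma)\}$. An ample Hausdorff groupoid is effective if the interior of $\operatorname{Iso}(G)$ in $G$ equals $G^{(0)}$. A subset $U\subseteq G^{(0)}$ is invariant if $s(\gamma)\in U$ implies $r(\gamma)\in U$ for all $\gamma \in G$; then $G_U:=s^{-1}(U)=\{\gamma: r(\gamma),s(\gamma)\in U\}$ is a groupoid with unit space $U$ (subspace topology). $G$ is strongly effective if $G_V$ is effective for every nonempty closed invariant $V\subseteq G^{(0)}$. Steinberg algebra. $A_{\mathbb{F}}(G)$ is the $\mathbb{F}$-algebra of all locally constant, compactly supported functions $f:G\to \mathbb{F}$ with pointwise addition and convolution $(f*g)(\gamma)=\sum_{\beta: r(\beta)=r(\gamma)} f(\beta)g(\beta^{-1}\gamma)$; $\operatorname{supp} f=\{\gamma: f(\gamma)\ne 0\}$. Ideals are two-sided. Lattices. Open invariant subsets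 (including $\emptyset$) are ordered by inclusion, with operations $\cup,\cap$; ideals are ordered by inclusion, with operations $+,\cap$. *)

theory Defs
  imports "HOL-Analysis.Analysis"
begin

section \<open>Topological groupoids\<close>

text \<open>
  The unit space is a subset of the set of arrows, so \<open>rng\<close> and \<open>src\<close> take values in arrows.
  \<open>comp G a b\<close> is the product \<open>a b\<close> and is meaningful only if \<open>src G a = rng G b\<close>.
\<close>

record 'a top_groupoid =
  gtop :: "'a topology"
  rng :: "'a \<Rightarrow> 'a"
  src :: "'a \<Rightarrow> 'a"
  comp :: "'a \<Rightarrow> 'a \<Rightarrow> 'a"
  ginv :: "'a \<Rightarrow> 'a"

definition arrows :: "'a top_groupoid \<Rightarrow> 'a set" where
  "arrows G = topspace (gtop G)"

definition units :: "'a top_groupoid \<Rightarrow> 'a set" where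
  "units G = rng G ` arrows G"

definition unit_top :: "'a top_groupoid \<Rightarrow> 'a topology" where
  "unit_top G = subtopology (gtop G) (units G)"

definition composable :: "'a top_groupoid \<Rightarrow> ('a \<times> 'a) set" where
  "composable G = {(a, b). a \<in> arrows G \<and> b \<in> arrows G \<and> src G a = rng G b}"

locale groupoid =
  fixes G :: "'a top_groupoid"
  assumes src_unit: "a \<in> arrows G \<Longrightarrow> src G a \<in> units G"
    and unit_arrow: "u \<in> units G \<Longrightarrow> u \<in> arrows G"
    and rng_of_unit: "u \<in> units G \<Longrightarrow> rng G u = u"
    and src_of_unit: "u \<in> units G \<Longrightarrow> src G u = u"
    and comp_arrow: "(a, b) \<in> composable G \<Longrightarrow> comp G a b \<in> arrows G"
    and rng_comp: "(a, b) \<in> composable G \<Longrightarrow> rng G (comp G a b) = rng G a"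
    and src_comp: "(a, b) \<in> composable G \<Longrightarrow> src G (comp G a b) = src G b"
    and comp_assoc: "\<lbrakk>(a, b) \<in> composable G; (b, c) \<in> composable G\<rbrakk>
      \<Longrightarrow> comp G (comp G a b) c = comp G a (comp G b c)"
    and rng_left_unit: "a \<in> arrows G \<Longrightarrow> comp G (rng G a) a = a"
    and src_right_unit: "a \<in> arrows G \<Longrightarrow> comp G a (src G a) = a"
    and ginv_arrow: "a \<in> arrows G \<Longrightarrow> ginv G a \<in> arrows G"
    and rng_ginv: "a \<in> arrows G \<Longrightarrow> rng G (ginv G a) = src G a"
    and src_ginv: "a \<in> arrows G \<Longrightarrow> src G (ginv G a) = rng G a"
    and comp_ginv_right: "a \<in> arrows G \<Longrightarrow> comp G a (ginv G a) = rng G a"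
    and comp_ginv_left: "a \<in> arrows G \<Longrightarrow> comp G (ginv G a) a = src G a"

text \<open>
  Continuity of \<open>rng\<close> and \<open>src\<close> is a consequence, because \<open>rng G a = comp G a (ginv G a)\<close>
  and \<open>src G a = comp G (ginv G a) a\<close>.
\<close>

locale topological_groupoid = groupoid G for G :: "'a top_groupoid" +
  assumes continuous_comp:
      "continuous_map (subtopology (prod_topology (gtop G) (gtop G)) (composable G)) (gtop G)
         (\<lambda>(a, b). comp G a b)"
    and continuous_ginv: "continuous_map (gtop G) (gtop G) (ginv G)"

definition open_bisection :: "'a top_groupoid \<Rightarrow> 'a set \<Rightarrow> bool" where
  "open_bisection G B \<longleftrightarrow> openin (gtop G) B \<and>
     (\<forall>p \<in> {rng G, src G}. openin (unit_top G) (p ` B) \<and>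
        homeomorphic_map (subtopology (gtop G) B) (subtopology (unit_top G) (p ` B)) p)"

locale ample_groupoid = topological_groupoid G for G :: "'a top_groupoid" +
  assumes compact_open_bisection_basis:
    "\<lbrakk>openin (gtop G) W; a \<in> W\<rbrakk>
      \<Longrightarrow> \<exists>B. open_bisection G B \<and> compactin (gtop G) B \<and> a \<in> B \<and> B \<subseteq> W"

definition isotropy :: "'a top_groupoid \<Rightarrow> 'a set" where
  "isotropy G = {a \<in> arrows G. rng G a = src G a}"

definition effective :: "'a top_groupoid \<Rightarrow> bool" where
  "effective G \<longleftrightarrow> gtop G interior_of isotropy G = units G"

definition invariant :: "'a top_groupoid \<Rightarrow> 'a set \<Rightarrow> bool" where
  "invariant G U \<longleftrightarrow> U \<subseteq> units G \<and> (\<forall>a \<in> arrows G. src G a \<in> U \<longrightarrow> rng G a \<in> U)"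

definition restriction :: "'a top_groupoid \<Rightarrow> 'a set \<Rightarrow> 'a top_groupoid" where
  "restriction G U = G\<lparr>gtop := subtopology (gtop G) {a \<in> arrows G. src G a \<in> U}\<rparr>"

lemma arrows_restriction: "arrows (restriction G U) = {a \<in> arrows G. src G a \<in> U}"
  by (auto simp: restriction_def arrows_def)

lemma (in groupoid) units_restriction:
  assumes "invariant G U"
  shows "units (restriction G U) = U"
proof -
  have [simp]: "rng (restriction G U) = rng G"
    by (simp add: restriction_def)
  have "U \<subseteq> rng G ` {a \<in> arrows G. src G a \<in> U}"
  proof
    fix u assume u: "u \<in> U"
    with assms have "u \<in> units G"
      by (auto simp: invariant_def)
    then have "u = rng G u \<and> u \<in> {a \<in> arrows G. src G a \<in> U}"
      using u rng_of_unit src_of_unit unit_arrow by simp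
    then show "u \<in> rng G ` {a \<in> arrows G. src G a \<in> U}"
      by blast
  qed
  then show ?thesis
    using assms by (auto simp: units_def arrows_restriction invariant_def)
qed

lemma (in groupoid) groupoid_restriction:
  assumes U: "invariant G U"
  shows "groupoid (restriction G U)"
proof -
  have arr: "a \<in> arrows G" if "a \<in> U" for a
    using that U unit_arrow by (auto simp: invariant_def)
  have inU: "rng G a \<in> U" if "a \<in> arrows G" "src G a \<in> U" for a
    using that U by (auto simp: invariant_def)
  have un: "u \<in> units G" if "u \<in> U" for u
    using that U by (auto simp: invariant_def)
  have [simp]: "rng (restriction G U) = rng G" "src (restriction G U) = src G"
    "comp (restriction G U) = comp G" "ginv (restriction G U) = ginv G"
    by (simp_all add: restriction_def)
  have co: "(a, b) \<in> composable (restriction G U)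
      \<longleftrightarrow> (a, b) \<in> composable G \<and> src G a \<in> U \<and> src G b \<in> U" for a b
    by (auto simp: composable_def arrows_restriction)
  show ?thesis
    unfolding groupoid_def units_restriction[OF U] arrows_restriction co
    using arr inU un
    by (auto simp: rng_of_unit src_of_unit comp_arrow rng_comp src_comp comp_assoc
        rng_left_unit src_right_unit ginv_arrow rng_ginv src_ginv comp_ginv_right comp_ginv_left)
qed

definition strongly_effective :: "'a top_groupoid \<Rightarrow> bool" where
  "strongly_effective G \<longleftrightarrow>
     (\<forall>V. V \<noteq> {} \<longrightarrow> closedin (unit_top G) V \<longrightarrow> invariant G V \<longrightarrow> effective (restriction G V))"

definition open_invariants :: "'a top_groupoid \<Rightarrow> 'a set set" where
  "open_invariants G = {U. openin (unit_top G) U \<and> invariant G U}"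


section \<open>Steinberg algebras and their ideals\<close>

definition supp :: "'a top_groupoid \<Rightarrow> ('a \<Rightarrow> 'f::field) \<Rightarrow> 'a set" where
  "supp G f = {a \<in> arrows G. f a \<noteq> 0}"

definition locally_constant :: "'a top_groupoid \<Rightarrow> ('a \<Rightarrow> 'f::field) \<Rightarrow> bool" where
  "locally_constant G f \<longleftrightarrow>
     (\<forall>a \<in> arrows G. \<exists>W. openin (gtop G) W \<and> a \<in> W \<and> (\<forall>b \<in> W. f b = f a))"

text \<open>
  A function on the arrows is represented by its extension by zero to the whole type, so that
  equality of functions is equality on arrows.  The support of a locally constant function is
  closed in the space of arrows, so no closure is needed in the compactness condition.
\<close>

definition steinberg :: "'a top_groupoid \<Rightarrow> ('a \<Rightarrow> 'f::field) set" where
  "steinberg G =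
     {f. (\<forall>a. a \<notin> arrows G \<longrightarrow> f a = 0) \<and> locally_constant G f \<and> compactin (gtop G) (supp G f)}"

text \<open>
  Terms with \<open>f b = 0\<close> are left out because \<open>sum\<close> is zero on infinite index sets.  For \<open>f\<close> in the
  Steinberg algebra of an ample Hausdorff groupoid the remaining index set is finite.
\<close>

definition convolution ::
    "'a top_groupoid \<Rightarrow> ('a \<Rightarrow> 'f::field) \<Rightarrow> ('a \<Rightarrow> 'f) \<Rightarrow> 'a \<Rightarrow> 'f" where
  "convolution G f g c =
     (if c \<in> arrows G
      then \<Sum>b \<in> {b \<in> arrows G. rng G b = rng G c \<and> f b \<noteq> 0}. f b * g (comp G (ginv G b) c)
      else 0)"

text \<open>
  Ideals of an algebra over a field, hence linear subspaces.  The Steinberg algebra of an ample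
  Hausdorff groupoid has local units, so closure under scalars also follows from the other
  conditions, and these are exactly the two-sided ideals of the underlying ring.
\<close>

definition steinberg_ideals :: "'a top_groupoid \<Rightarrow> ('a \<Rightarrow> 'f::field) set set" where
  "steinberg_ideals G =
     {I. I \<subseteq> steinberg G \<and> (\<lambda>a. 0) \<in> I \<and>
         (\<forall>f \<in> I. \<forall>g \<in> I. (\<lambda>a. f a + g a) \<in> I) \<and>
         (\<forall>k. \<forall>f \<in> I. (\<lambda>a. k * f a) \<in> I) \<and>
         (\<forall>h \<in> steinberg G. \<forall>f \<in> I. convolution G h f \<in> I \<and> convolution G f h \<in> I)}"

definition ideal_sum :: "('a \<Rightarrow> 'f::field) set \<Rightarrow> ('a \<Rightarrow> 'f) set \<Rightarrow> ('a \<Rightarrow> 'f) set" where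
  "ideal_sum I J = {(\<lambda>a. f a + g a) |f g. f \<in> I \<and> g \<in> J}"

definition ideal_of :: "'a top_groupoid \<Rightarrow> 'a set \<Rightarrow> ('a \<Rightarrow> 'f::field) set" where
  "ideal_of G U = {f \<in> steinberg G. supp G f \<subseteq> arrows (restriction G U)}"


section \<open>Lattice isomorphisms\<close>

text \<open>Both lattices are families of sets ordered by inclusion, with the given joins and meets.\<close>

definition lattice_isomorphism ::
    "('b set \<Rightarrow> 'c set) \<Rightarrow>
     'b set set \<Rightarrow> ('b set \<Rightarrow> 'b set \<Rightarrow> 'b set) \<Rightarrow> ('b set \<Rightarrow> 'b set \<Rightarrow> 'b set) \<Rightarrow>
     'c set set \<Rightarrow> ('c set \<Rightarrow> 'c set \<Rightarrow> 'c set) \<Rightarrow> ('c set \<Rightarrow> 'c set \<Rightarrow> 'c set) \<Rightarrow> bool" where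
  "lattice_isomorphism \<phi> L join meet L' join' meet' \<longleftrightarrow>
     bij_betw \<phi> L L' \<and>
     (\<forall>x \<in> L. \<forall>y \<in> L. (\<phi> x \<subseteq> \<phi> y \<longleftrightarrow> x \<subseteq> y) \<and>
        \<phi> (join x y) = join' (\<phi> x) (\<phi> y) \<and> \<phi> (meet x y) = meet' (\<phi> x) (\<phi> y))"

end

theory Submission
  imports Defs
begin

text \<open>
  An ideal \<open>I\<close> is determined by the open invariant set \<open>U\<close> of units covered by compact open sets
  \<open>K\<close> of units with \<open>indicator K \<in> I\<close>.  Every function supported over \<open>U\<close> is fixed by right
  multiplication with such an indicator, hence lies in \<open>I\<close>.  Conversely, suppose that some element
  of \<open>I\<close> is nonzero at an arrow with source in the closed invariant complement \<open>V\<close> of \<open>U\<close>, and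
  translate it so that this arrow is a unit.  As the restriction to \<open>V\<close> is effective, a small
  \<open>K\<close> meeting \<open>V\<close> avoids, over \<open>V\<close>, the finitely many bisections that carry the rest of the
  function.  Compressing to \<open>K\<close> leaves a nonzero multiple of \<open>indicator K\<close> plus a function
  supported over \<open>U\<close>, so \<open>indicator K \<in> I\<close>, a contradiction.
\<close>

section \<open>Groupoid algebra\<close>

context groupoid
begin

lemma rng_unit: "a \<in> arrows G \<Longrightarrow> rng G a \<in> units G"
  by (simp add: units_def)

lemma comp_arrow': "\<lbrakk>a \<in> arrows G; b \<in> arrows G; src G a = rng G b\<rbrakk> \<Longrightarrow> comp G a b \<in> arrows G"
  and rng_comp': "\<lbrakk>a \<in> arrows G; b \<in> arrows G; src G a = rng G b\<rbrakk> \<Longrightarrow> rng G (comp G a b) = rng G a"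
  and src_comp': "\<lbrakk>a \<in> arrows G; b \<in> arrows G; src G a = rng G b\<rbrakk> \<Longrightarrow> src G (comp G a b) = src G b"
  by (simp_all add: comp_arrow rng_comp src_comp composable_def)

lemmas groupoid_simps [simp] = rng_unit src_unit unit_arrow rng_of_unit src_of_unit comp_arrow'
  rng_comp' src_comp' rng_left_unit src_right_unit ginv_arrow rng_ginv src_ginv
  comp_ginv_right comp_ginv_left

lemma comp_ginv_cancel [simp]:
  assumes "a \<in> arrows G" "c \<in> arrows G" "rng G a = rng G c"
  shows "comp G a (comp G (ginv G a) c) = c"
  using comp_assoc[of a "ginv G a" c] assms by (simp add: composable_def)

lemma ginv_comp_cancel [simp]:
  assumes "a \<in> arrows G" "c \<in> arrows G" "src G a = rng G c"
  shows "comp G (ginv G a) (comp G a c) = c"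
  using comp_assoc[of "ginv G a" a c] assms by (simp add: composable_def)

text \<open>Multiplying \<open>comp G (ginv G a) a\<close> on the left by
  \<open>ginv G (ginv G a)\<close> gives \<open>a\<close> by cancellation, and gives
  \<open>ginv G (ginv G a)\<close> because the multiplied element is a unit.\<close>

lemma ginv_ginv [simp]:
  assumes "a \<in> arrows G"
  shows "ginv G (ginv G a) = a"
proof -
  have "comp G (ginv G (ginv G a)) (comp G (ginv G a) a) = a"
    using assms by (intro ginv_comp_cancel) auto
  moreover have "comp G (ginv G (ginv G a)) (src G (ginv G (ginv G a))) = ginv G (ginv G a)"
    using assms by (intro src_right_unit) auto
  ultimately show ?thesis
    using assms by simp
qed

text \<open>A unit equals its own range, here \<open>src G a\<close>, so multiplying back by
  \<open>a\<close> gives \<open>c = a\<close>. This leaves one term in a convolution whose right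
  factor is the indicator of a set of units.\<close>

lemma comp_ginv_unit_iff:
  assumes "a \<in> arrows G" "c \<in> arrows G" "rng G a = rng G c"
  shows "comp G (ginv G a) c \<in> units G \<longleftrightarrow> a = c"
proof
  assume u: "comp G (ginv G a) c \<in> units G"
  then have "comp G (ginv G a) c = rng G (comp G (ginv G a) c)"
    by simp
  also have "\<dots> = src G a"
    using assms by simp
  finally show "a = c"
    using comp_ginv_cancel[OF assms] assms(1) by simp
qed (use assms in auto)

text \<open>The definition gives one direction; the other is the definition applied to
  \<open>ginv G a\<close>.\<close>

lemma invariant_iff:
  assumes "invariant G U" "a \<in> arrows G"
  shows "rng G a \<in> U \<longleftrightarrow> src G a \<in> U"
proof -
  have "src G (ginv G a) \<in> U \<longrightarrow> rng G (ginv G a) \<in> U" "src G a \<in> U \<longrightarrow> rng G a \<in> U"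
    using assms ginv_arrow[OF assms(2)] unfolding invariant_def by blast+
  then show ?thesis
    using assms(2) by auto
qed

lemma invariant_Diff:
  assumes "invariant G U"
  shows "invariant G (units G - U)"
  using invariant_iff[OF assms] by (auto simp: invariant_def)

end

section \<open>Topology of ample groupoids\<close>

definition compact_open_bisection :: "'a top_groupoid \<Rightarrow> 'a set \<Rightarrow> bool" where
  "compact_open_bisection G B \<longleftrightarrow> open_bisection G B \<and> compactin (gtop G) B"

lemma topspace_gtop [simp]: "topspace (gtop G) = arrows G"
  by (simp add: arrows_def)

lemma openin_arrows: "openin (gtop G) W \<Longrightarrow> W \<subseteq> arrows G"
  using openin_subset by fastforce

lemma open_bisection_openin: "open_bisection G B \<Longrightarrow> openin (gtop G) B"
  by (simp add: open_bisection_def)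

lemma open_bisection_arrows: "open_bisection G B \<Longrightarrow> B \<subseteq> arrows G"
  by (simp add: open_bisection_openin openin_arrows)

lemma open_bisection_inj_on:
  assumes "open_bisection G B"
  shows "inj_on (rng G) B" "inj_on (src G) B"
proof -
  have "inj_on p B" if "p \<in> {rng G, src G}" for p
  proof -
    have "homeomorphic_map (subtopology (gtop G) B) (subtopology (unit_top G) (p ` B)) p"
      using assms that unfolding open_bisection_def by blast
    then show ?thesis
      using homeomorphic_imp_injective_map open_bisection_arrows[OF assms]
      by (fastforce simp: Int_absorb1)
  qed
  then show "inj_on (rng G) B" "inj_on (src G) B"
    by auto
qed

context topological_groupoid
begin

lemma continuous_rng: "continuous_map (gtop G) (gtop G) (rng G)"
proof -
  have "continuous_map (gtop G) (gtop G) ((\<lambda>(a, b). comp G a b) \<circ> (\<lambda>a. (a, ginv G a)))"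
    by (rule continuous_map_compose[OF _ continuous_comp])
      (auto simp: continuous_map_in_subtopology continuous_map_pairwise composable_def o_def
        continuous_ginv)
  then show ?thesis
    by (rule continuous_map_eq) auto
qed

lemma continuous_src: "continuous_map (gtop G) (gtop G) (src G)"
proof -
  have "continuous_map (gtop G) (gtop G) (rng G \<circ> ginv G)"
    by (rule continuous_map_compose[OF continuous_ginv continuous_rng])
  then show ?thesis
    by (rule continuous_map_eq) auto
qed

lemma openin_rng_vimage:
  "openin (gtop G) W \<Longrightarrow> openin (gtop G) {a \<in> arrows G. rng G a \<in> W}"
  using openin_continuous_map_preimage[OF continuous_rng] by simp

lemma openin_src_vimage:
  "openin (gtop G) W \<Longrightarrow> openin (gtop G) {a \<in> arrows G. src G a \<in> W}"
  using openin_continuous_map_preimage[OF continuous_src] by simp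

lemma openin_ginv_vimage:
  "openin (gtop G) W \<Longrightarrow> openin (gtop G) {a \<in> arrows G. ginv G a \<in> W}"
  using openin_continuous_map_preimage[OF continuous_ginv] by simp

text \<open>Continuity of multiplication in box form: the preimage of \<open>W\<close> is the trace
  on \<open>composable G\<close> of an open set \<open>T\<close>, and \<open>T\<close> contains an
  open box around \<open>(a, b)\<close>.\<close>

lemma comp_neighbourhoods:
  assumes "openin (gtop G) W" "a \<in> arrows G" "b \<in> arrows G" "src G a = rng G b" "comp G a b \<in> W"
  obtains P Q where "openin (gtop G) P" "openin (gtop G) Q" "a \<in> P" "b \<in> Q"
    "\<And>x y. \<lbrakk>x \<in> P; y \<in> Q; src G x = rng G y\<rbrakk> \<Longrightarrow> comp G x y \<in> W"
proof -
  let ?P = "prod_topology (gtop G) (gtop G)"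
  have "openin (subtopology ?P (composable G))
          {x \<in> topspace (subtopology ?P (composable G)). (case x of (a, b) \<Rightarrow> comp G a b) \<in> W}"
    by (rule openin_continuous_map_preimage[OF continuous_comp assms(1)])
  then obtain T where T: "openin ?P T"
    "{x \<in> topspace (subtopology ?P (composable G)). (case x of (a, b) \<Rightarrow> comp G a b) \<in> W}
       = T \<inter> composable G"
    unfolding openin_subtopology by metis
  have "(a, b) \<in> {x \<in> topspace (subtopology ?P (composable G)).
                  (case x of (a, b) \<Rightarrow> comp G a b) \<in> W}"
    using assms by (auto simp: composable_def)
  then have "(a, b) \<in> T"
    unfolding T(2) by blast
  then obtain P Q where PQ: "openin (gtop G) P" "openin (gtop G) Q" "a \<in> P" "b \<in> Q" "P \<times> Q \<subseteq> T"
    using T(1) unfolding openin_prod_topology_alt by metis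
  moreover have "comp G x y \<in> W" if "x \<in> P" "y \<in> Q" "src G x = rng G y" for x y
  proof -
    have "(x, y) \<in> T \<inter> composable G"
      using that PQ openin_arrows by (fastforce simp: composable_def)
    then show ?thesis
      unfolding T(2)[symmetric] by simp
  qed
  ultimately show ?thesis
    using that by blast
qed

lemma compactin_ginv_image:
  assumes "compactin (gtop G) B"
  shows "compactin (gtop G) (ginv G ` B)"
  using image_compactin[OF assms continuous_ginv] .

text \<open>Inversion is an involution, so the image is also a preimage under a continuous
  map.\<close>

lemma openin_ginv_image:
  assumes "openin (gtop G) B"
  shows "openin (gtop G) (ginv G ` B)"
proof -
  have "ginv G ` B = {a \<in> arrows G. ginv G a \<in> B}"
    using openin_arrows[OF assms] ginv_ginv by (force simp: image_iff)
  then show ?thesis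
    using openin_ginv_vimage[OF assms] by simp
qed

end

context ample_groupoid
begin

lemma compact_open_bisection_at:
  assumes "openin (gtop G) W" "a \<in> W"
  obtains B where "compact_open_bisection G B" "a \<in> B" "B \<subseteq> W"
  using compact_open_bisection_basis[OF assms] unfolding compact_open_bisection_def by metis

text \<open>Near a unit in a bisection \<open>B\<close>, an arrow \<open>b \<in> B\<close> with \<open>rng G b \<in> B\<close> has the same range
  as \<open>rng G b\<close>, and so equals it.\<close>

lemma openin_units: "openin (gtop G) (units G)"
proof (subst openin_subopen, intro ballI)
  fix u assume u: "u \<in> units G"
  then obtain B where B: "compact_open_bisection G B" "u \<in> B"
    using compact_open_bisection_at[of "arrows G" u] by (metis openin_topspace topspace_gtop unit_arrow)
  then have ob: "open_bisection G B"
    by (simp add: compact_open_bisection_def)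
  let ?W = "B \<inter> {a \<in> arrows G. rng G a \<in> B}"
  have "openin (gtop G) ?W"
    using open_bisection_openin[OF ob] by (intro openin_Int openin_rng_vimage)
  moreover have "u \<in> ?W"
    using u B by simp
  moreover have "b \<in> units G" if "b \<in> ?W" for b
  proof -
    have "rng G b = b"
      by (rule inj_onD[OF open_bisection_inj_on(1)[OF ob]]) (use that in auto)
    then show ?thesis
      using that rng_unit[of b] by auto
  qed
  ultimately show "\<exists>T. openin (gtop G) T \<and> u \<in> T \<and> T \<subseteq> units G"
    by blast
qed

lemma openin_unit_top_iff: "openin (unit_top G) W \<longleftrightarrow> openin (gtop G) W \<and> W \<subseteq> units G"
  unfolding unit_top_def using openin_units by (rule openin_open_subtopology)

text \<open>Every arrow of \<open>W\<close> lies in a bisection inside \<open>W\<close>, whose image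
  is open in the unit space. That image is open in \<open>G\<close> because the units are.\<close>

lemma openin_image:
  assumes W: "openin (gtop G) W" and p: "p \<in> {rng G, src G}"
  shows "openin (gtop G) (p ` W)"
proof (subst openin_subopen, intro ballI)
  fix x assume "x \<in> p ` W"
  then obtain a where a: "a \<in> W" "x = p a"
    by blast
  then obtain B where B: "compact_open_bisection G B" "a \<in> B" "B \<subseteq> W"
    using compact_open_bisection_at W by metis
  have "openin (gtop G) (p ` B)"
    using B p unfolding compact_open_bisection_def open_bisection_def openin_unit_top_iff by blast
  then show "\<exists>T. openin (gtop G) T \<and> x \<in> T \<and> T \<subseteq> p ` W"
    using a B by blast
qed

text \<open>The side condition \<open>P\<close> is later instantiated by bisections whose sources
  stay in one of two open sets, and by bisections that miss the units.\<close>

lemma compact_open_bisection_cover: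
  assumes K: "compactin (gtop G) K"
    and P: "\<And>a. a \<in> K \<Longrightarrow> \<exists>B. compact_open_bisection G B \<and> a \<in> B \<and> P B"
  shows "\<exists>\<B>. finite \<B> \<and> (\<forall>B \<in> \<B>. compact_open_bisection G B \<and> P B) \<and> K \<subseteq> \<Union>\<B>"
proof -
  let ?C = "{B. compact_open_bisection G B \<and> P B}"
  have "\<exists>\<B>. finite \<B> \<and> \<B> \<subseteq> ?C \<and> K \<subseteq> \<Union>\<B>"
  proof (rule compactinD[OF K])
    show "K \<subseteq> \<Union>?C"
      using P by blast
  qed (simp add: compact_open_bisection_def open_bisection_openin)
  then show ?thesis
    by blast
qed

end

locale hausdorff_ample_groupoid = ample_groupoid +
  assumes hausdorff: "Hausdorff_space (gtop G)"
begin

lemma compactin_closedin: "compactin (gtop G) K \<Longrightarrow> closedin (gtop G) K"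
  using hausdorff compactin_imp_closedin by blast

text \<open>The units are the fixed points of \<open>rng G\<close>, an equaliser of continuous maps
  into a Hausdorff space. Consequently every non-unit arrow lies in a bisection that misses the
  units.\<close>

lemma closedin_units: "closedin (gtop G) (units G)"
proof -
  have "units G = {a \<in> arrows G. rng G a = a}"
    by (auto dest: rng_unit)
  moreover have "closedin (gtop G) {a \<in> arrows G. rng G a = a}"
    using closedin_continuous_maps_eq[OF hausdorff continuous_rng continuous_map_id] by simp
  ultimately show ?thesis
    by (rule ssubst)
qed

text \<open>Composability is an equaliser of continuous maps into a Hausdorff space, so the
  composable pairs in \<open>K \<times> L\<close> form a compact set. This bounds the support of a
  convolution.\<close>

lemma compactin_comp_image:
  assumes "compactin (gtop G) K" "compactin (gtop G) L"
  shows "compactin (gtop G) ((\<lambda>(a, b). comp G a b) ` (K \<times> L \<inter> composable G))"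
proof -
  let ?P = "prod_topology (gtop G) (gtop G)"
  have "continuous_map ?P (gtop G) (src G \<circ> fst)" "continuous_map ?P (gtop G) (rng G \<circ> snd)"
    by (meson continuous_map_compose continuous_map_fst continuous_map_snd continuous_rng
        continuous_src)+
  then have "closedin ?P {x \<in> topspace ?P. (src G \<circ> fst) x = (rng G \<circ> snd) x}"
    by (rule closedin_continuous_maps_eq[OF hausdorff])
  also have "{x \<in> topspace ?P. (src G \<circ> fst) x = (rng G \<circ> snd) x} = composable G"
    by (auto simp: composable_def)
  finally have "compactin ?P (K \<times> L \<inter> composable G)"
    using assms by (simp add: compactin_Times compact_Int_closedin)
  then have "compactin (subtopology ?P (composable G)) (K \<times> L \<inter> composable G)"
    by (simp add: compactin_subtopology)
  then show ?thesis
    by (rule image_compactin[OF _ continuous_comp])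
qed

end

section \<open>Functions in the Steinberg algebra\<close>

lemma locally_constant_binop:
  assumes "locally_constant G f" "locally_constant G g"
  shows "locally_constant G (\<lambda>a. F (f a) (g a))"
  unfolding locally_constant_def
proof
  fix a assume "a \<in> arrows G"
  then obtain V W where "openin (gtop G) V" "a \<in> V" "\<forall>b \<in> V. f b = f a"
    "openin (gtop G) W" "a \<in> W" "\<forall>b \<in> W. g b = g a"
    using assms unfolding locally_constant_def by metis
  then show "\<exists>W. openin (gtop G) W \<and> a \<in> W \<and> (\<forall>b \<in> W. F (f b) (g b) = F (f a) (g a))"
    by (intro exI[of _ "V \<inter> W"] conjI openin_Int ballI) (metis IntD1 IntD2 IntI)+
qed

lemma locally_constant_indicator:
  assumes "openin (gtop G) B" "closedin (gtop G) B"
  shows "locally_constant G (indicator B)"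
  unfolding locally_constant_def
proof
  fix a assume a: "a \<in> arrows G"
  show "\<exists>W. openin (gtop G) W \<and> a \<in> W \<and> (\<forall>b \<in> W. indicator B b = indicator B a)"
  proof (cases "a \<in> B")
    case True
    then show ?thesis
      using assms(1) by (intro exI[of _ B]) auto
  next
    case False
    then show ?thesis
      using assms(2) a by (intro exI[of _ "arrows G - B"]) (auto simp: closedin_def)
  qed
qed

lemma closedin_supp:
  assumes "locally_constant G f"
  shows "closedin (gtop G) (supp G f)"
proof -
  have "openin (gtop G) (arrows G - supp G f)"
  proof (subst openin_subopen, intro ballI)
    fix a assume "a \<in> arrows G - supp G f"
    then have a: "a \<in> arrows G" "f a = 0"
      by (auto simp: supp_def)
    then obtain W where "openin (gtop G) W" "a \<in> W" "\<forall>b \<in> W. f b = f a"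
      using assms unfolding locally_constant_def by metis
    then show "\<exists>T. openin (gtop G) T \<and> a \<in> T \<and> T \<subseteq> arrows G - supp G f"
      using a openin_arrows[of G W] by (intro exI[of _ W]) (auto simp: supp_def)
  qed
  then show ?thesis
    by (auto simp: closedin_def supp_def)
qed

text \<open>The support of a locally constant function is closed, so it is compact once it lies in
  some compact \<open>K\<close>.\<close>

lemma steinbergI:
  assumes "\<And>a. a \<notin> arrows G \<Longrightarrow> f a = 0" "locally_constant G f"
    "compactin (gtop G) K" "supp G f \<subseteq> K"
  shows "f \<in> steinberg G"
  unfolding steinberg_def
  using assms(1,2) closed_compactin[OF assms(3,4) closedin_supp[OF assms(2)]] by blast

lemma steinbergD:
  assumes "f \<in> steinberg G"
  shows "a \<notin> arrows G \<Longrightarrow> f a = 0" "locally_constant G f" "compactin (gtop G) (supp G f)"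
  using assms by (auto simp: steinberg_def)

lemma locally_constant_const: "locally_constant G (\<lambda>a. k)"
  unfolding locally_constant_def by (metis openin_topspace topspace_gtop)

lemma steinberg_zero: "(\<lambda>a. 0) \<in> steinberg G"
  by (rule steinbergI[where K = "{}"]) (auto simp: locally_constant_const supp_def)

lemma steinberg_add:
  assumes "f \<in> steinberg G" "g \<in> steinberg G"
  shows "(\<lambda>a. f a + g a) \<in> steinberg G"
proof (rule steinbergI)
  show "locally_constant G (\<lambda>a. f a + g a)"
    using steinbergD(2)[OF assms(1)] steinbergD(2)[OF assms(2)] by (rule locally_constant_binop)
  show "compactin (gtop G) (supp G f \<union> supp G g)"
    using assms by (intro compactin_Un steinbergD(3))
  show "f a + g a = 0" if "a \<notin> arrows G" for a
    using that steinbergD(1)[OF assms(1)] steinbergD(1)[OF assms(2)] by simp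
qed (auto simp: supp_def)

text \<open>This is the pointwise product, used for scaling and for truncating a function to a
  clopen set.\<close>

lemma steinberg_times:
  assumes "f \<in> steinberg G" "locally_constant G g"
  shows "(\<lambda>a. f a * g a) \<in> steinberg G"
proof (rule steinbergI)
  show "locally_constant G (\<lambda>a. f a * g a)"
    using steinbergD(2)[OF assms(1)] assms(2) by (rule locally_constant_binop)
  show "compactin (gtop G) (supp G f)"
    using assms(1) by (rule steinbergD(3))
  show "f a * g a = 0" if "a \<notin> arrows G" for a
    using that steinbergD(1)[OF assms(1)] by simp
qed (auto simp: supp_def)

lemma steinberg_scale:
  assumes "f \<in> steinberg G"
  shows "(\<lambda>a. k * f a) \<in> steinberg G"
  using steinberg_times[OF assms locally_constant_const[of G k]] by (simp add: mult.commute)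

section \<open>Evaluating convolutions on a range fibre\<close>

lemma convolution_eq_zero:
  assumes "\<And>b. \<lbrakk>b \<in> arrows G; rng G b = rng G c\<rbrakk> \<Longrightarrow> h b = 0"
  shows "convolution G h f c = 0"
proof -
  have "{b \<in> arrows G. rng G b = rng G c \<and> h b \<noteq> 0} = {}"
    using assms by auto
  then show ?thesis
    unfolding convolution_def by simp
qed

text \<open>A set on which \<open>rng G\<close> is injective meets each range fibre at most once, so
  only the summand at \<open>b\<close> can survive.\<close>

lemma convolution_inj_on:
  assumes "inj_on (rng G) B" "\<And>a. a \<notin> B \<Longrightarrow> h a = 0"
    and "b \<in> B" "b \<in> arrows G" "c \<in> arrows G" "rng G b = rng G c"
  shows "convolution G h f c = h b * f (comp G (ginv G b) c)"
proof -
  have uniq: "b' = b" if "rng G b' = rng G c" "h b' \<noteq> 0" for b'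
  proof (rule inj_onD[OF assms(1)])
    show "b' \<in> B"
      using assms(2) that(2) by blast
  qed (use assms(3,6) that(1) in simp_all)
  show ?thesis
  proof (cases "h b = 0")
    \<comment> \<open>The index set omits zeros of \<open>h\<close>, so here it is empty rather than
      \<open>{b}\<close>.\<close>
    case True
    have "convolution G h f c = 0"
      using uniq True by (intro convolution_eq_zero) blast
    with True show ?thesis
      by simp
  next
    case False
    then have "{b' \<in> arrows G. rng G b' = rng G c \<and> h b' \<noteq> 0} = {b}"
      using uniq assms(4,6) by blast
    then show ?thesis
      unfolding convolution_def using assms(5) by simp
  qed
qed

lemma convolution_nonzeroE:
  assumes "convolution G h f c \<noteq> 0"
  obtains b where "c \<in> arrows G" "b \<in> arrows G" "rng G b = rng G c" "h b \<noteq> 0"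
    "f (comp G (ginv G b) c) \<noteq> 0"
proof -
  have c: "c \<in> arrows G"
    using assms unfolding convolution_def by presburger
  with assms obtain b where "b \<in> {b \<in> arrows G. rng G b = rng G c \<and> h b \<noteq> 0}"
    "h b * f (comp G (ginv G b) c) \<noteq> 0"
    unfolding convolution_def by (metis (no_types, lifting) sum.neutral)
  with c show ?thesis
    using that by auto
qed

context groupoid
begin

text \<open>On units \<open>rng G\<close> is the identity, hence injective, and the only possible
  summand is at \<open>rng G c\<close>, which is its own inverse.\<close>

lemma convolution_indicator_left:
  assumes "K \<subseteq> units G" "c \<in> arrows G"
  shows "convolution G (indicator K) f c = indicator K (rng G c) * f c"
proof (cases "rng G c \<in> K")
  case True
  have "inj_on (rng G) K"
    using assms by (auto simp: inj_on_def subset_iff)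
  moreover have "ginv G (rng G c) = rng G c"
    using assms comp_ginv_right[of "rng G c"] rng_left_unit[of "ginv G (rng G c)"] by simp
  ultimately show ?thesis
    using True assms by (subst convolution_inj_on[of G K _ "rng G c"]) auto
next
  case False
  have "convolution G (indicator K) f c = 0"
    using False assms by (intro convolution_eq_zero) (auto simp: indicator_def subset_iff)
  with False show ?thesis
    by simp
qed

end

context hausdorff_ample_groupoid
begin

lemma indicator_steinberg:
  assumes "openin (gtop G) B" "compactin (gtop G) B"
  shows "indicator B \<in> steinberg G"
proof (rule steinbergI[OF _ _ assms(2)])
  show "locally_constant G (indicator B)"
    using assms by (intro locally_constant_indicator compactin_closedin)
qed (use openin_arrows[OF assms(1)] in \<open>auto simp: supp_def indicator_def\<close>)

lemma supp_cover:
  assumes "f \<in> steinberg G"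
  obtains \<B> where "finite \<B>" "\<And>B. B \<in> \<B> \<Longrightarrow> compact_open_bisection G B" "supp G f \<subseteq> \<Union>\<B>"
proof -
  have "\<exists>B. compact_open_bisection G B \<and> a \<in> B \<and> True" if "a \<in> supp G f" for a
    using that compact_open_bisection_at[of "arrows G" a]
    by (auto simp: supp_def) (metis openin_topspace topspace_gtop)
  from compact_open_bisection_cover[OF steinbergD(3)[OF assms] this] show ?thesis
    using that by auto
qed

text \<open>Finitely many bisections cover the compact support, and each has at most one arrow in a
  given range fibre. Hence the sums in \<open>convolution\<close> are genuine finite sums.\<close>

lemma finite_supp_fibre:
  assumes "f \<in> steinberg G"
  shows "finite {b \<in> arrows G. rng G b = u \<and> f b \<noteq> 0}"
proof -
  obtain \<B> where B: "finite \<B>" "\<And>B. B \<in> \<B> \<Longrightarrow> compact_open_bisection G B"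
    "supp G f \<subseteq> \<Union>\<B>"
    using supp_cover[OF assms] by metis
  have "finite {b \<in> B. rng G b = u}" if "B \<in> \<B>" for B
  proof -
    have "inj_on (rng G) B"
      using that B(2) open_bisection_inj_on(1) by (auto simp: compact_open_bisection_def)
    then have "inj_on (rng G) {b \<in> B. rng G b = u}"
      by (rule inj_on_subset) auto
    moreover have "finite (rng G ` {b \<in> B. rng G b = u})"
      by (rule finite_subset[of _ "{u}"]) auto
    ultimately show ?thesis
      using finite_imageD by blast
  qed
  then have "finite (\<Union>B \<in> \<B>. {b \<in> B. rng G b = u})"
    using B(1) by blast
  moreover have "{b \<in> arrows G. rng G b = u \<and> f b \<noteq> 0} \<subseteq> (\<Union>B \<in> \<B>. {b \<in> B. rng G b = u})"
    using B(3) by (auto simp: supp_def)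
  ultimately show ?thesis
    using finite_subset by blast
qed

text \<open>The product of \<open>ginv G b\<close> and \<open>c\<close> can lie in \<open>K\<close>
  only if it is a unit, that is, if \<open>b = c\<close>; then it equals \<open>src G c\<close>.
  Finiteness of the fibre allows the remaining sum to be evaluated.\<close>

lemma convolution_indicator_right:
  assumes f: "f \<in> steinberg G" and K: "K \<subseteq> units G" and c: "c \<in> arrows G"
  shows "convolution G f (indicator K) c = f c * indicator K (src G c)"
proof -
  let ?S = "{b \<in> arrows G. rng G b = rng G c \<and> f b \<noteq> 0}"
  have "f b * indicator K (comp G (ginv G b) c) = (if b = c then f c * indicator K (src G c) else 0)"
    if "b \<in> ?S" for b
    using that comp_ginv_unit_iff[of b c] K c by (auto simp: indicator_def)
  then have "(\<Sum>b \<in> ?S. f b * indicator K (comp G (ginv G b) c))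
      = (\<Sum>b \<in> ?S. if b = c then f c * indicator K (src G c) else 0)"
    by (rule sum.cong[OF refl])
  then have "convolution G f (indicator K) c
      = (\<Sum>b \<in> ?S. if b = c then f c * indicator K (src G c) else 0)"
    unfolding convolution_def using c by simp
  then show ?thesis
    using finite_supp_fibre[OF f] c by (simp add: sum.delta)
qed

section \<open>Closure under convolution\<close>

text \<open>The convolution at \<open>d\<close> reduces to the summand at the arrow of
  \<open>B\<close> with range \<open>rng G d\<close>. Since \<open>rng G\<close> is open, that arrow
  stays close to \<open>b\<close> when \<open>d\<close> is close to \<open>c\<close>, and local
  constancy of both factors applies.\<close>

lemma locally_constant_convolution_bisection:
  assumes B: "compact_open_bisection G B" and h: "h \<in> steinberg G" and f: "f \<in> steinberg G"
    and hB: "\<And>a. a \<notin> B \<Longrightarrow> h a = 0"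
  shows "locally_constant G (convolution G h f)"
  unfolding locally_constant_def
proof
  fix c assume c: "c \<in> arrows G"
  have ob: "open_bisection G B" and cB: "compactin (gtop G) B"
    using B by (auto simp: compact_open_bisection_def)
  note inj = open_bisection_inj_on(1)[OF ob]
  show "\<exists>W. openin (gtop G) W \<and> c \<in> W \<and> (\<forall>d \<in> W. convolution G h f d = convolution G h f c)"
  proof (cases "rng G c \<in> rng G ` B")
    case True
    then obtain b where b: "b \<in> B" "rng G b = rng G c"
      by auto
    then have ba: "b \<in> arrows G"
      using open_bisection_arrows[OF ob] by auto
    have bc: "comp G (ginv G b) c \<in> arrows G"
      using b ba c by simp
    obtain V where V: "openin (gtop G) V" "b \<in> V" "\<forall>x \<in> V. h x = h b"
      using steinbergD(2)[OF h] ba unfolding locally_constant_def by metis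
    obtain W where W: "openin (gtop G) W" "comp G (ginv G b) c \<in> W"
      "\<forall>x \<in> W. f x = f (comp G (ginv G b) c)"
      using steinbergD(2)[OF f] bc unfolding locally_constant_def by metis
    obtain P Q where PQ: "openin (gtop G) P" "openin (gtop G) Q" "ginv G b \<in> P" "c \<in> Q"
      "\<And>x y. \<lbrakk>x \<in> P; y \<in> Q; src G x = rng G y\<rbrakk> \<Longrightarrow> comp G x y \<in> W"
      using comp_neighbourhoods[OF W(1) _ c _ W(2)] ba b by auto
    let ?N = "B \<inter> V \<inter> {a \<in> arrows G. ginv G a \<in> P}"
    have "openin (gtop G) (rng G ` ?N)"
      using V PQ open_bisection_openin[OF ob]
      by (intro openin_image openin_Int openin_ginv_vimage) auto
    then have "openin (gtop G) (Q \<inter> {a \<in> arrows G. rng G a \<in> rng G ` ?N})"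
      using PQ by (intro openin_Int openin_rng_vimage)
    moreover have "c \<in> Q \<inter> {a \<in> arrows G. rng G a \<in> rng G ` ?N}"
      using PQ c b ba V by (auto intro!: image_eqI[of _ _ b])
    moreover have "convolution G h f d = convolution G h f c"
      if "d \<in> Q \<inter> {a \<in> arrows G. rng G a \<in> rng G ` ?N}" for d
    proof -
      from that obtain x where x: "x \<in> ?N" "rng G x = rng G d"
        by auto
      have d: "d \<in> Q" "d \<in> arrows G"
        using that by auto
      have "convolution G h f d = h x * f (comp G (ginv G x) d)"
        using x d by (intro convolution_inj_on[OF inj hB]) auto
      moreover have "convolution G h f c = h b * f (comp G (ginv G b) c)"
        using b ba c by (intro convolution_inj_on[OF inj hB])
      moreover have "h x = h b"
        using x V(3) by blast
      moreover have "comp G (ginv G x) d \<in> W"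
        using x d by (intro PQ(5)) auto
      then have "f (comp G (ginv G x) d) = f (comp G (ginv G b) c)"
        using W(3) by blast
      ultimately show ?thesis
        by simp
    qed
    ultimately show ?thesis
      by blast
  next
    case False
    have "closedin (gtop G) (rng G ` B)"
      using compactin_closedin image_compactin[OF cB continuous_rng] by blast
    then have "openin (gtop G) (arrows G - rng G ` B)"
      by (simp add: closedin_def)
    then have "openin (gtop G) {a \<in> arrows G. rng G a \<in> arrows G - rng G ` B}"
      by (rule openin_rng_vimage)
    moreover have "convolution G h f d = 0" if "rng G d \<notin> rng G ` B" for d
      using that by (intro convolution_eq_zero) (metis hB image_eqI)
    ultimately show ?thesis
      using c False
      by (intro exI[of _ "{a \<in> arrows G. rng G a \<in> arrows G - rng G ` B}"]) auto
  qed
qed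

text \<open>Additivity in the left factor for the decomposition of \<open>h\<close> along
  \<open>B\<close>. Each truncation has its own index set of nonzero terms; these are the two pieces
  into which \<open>B\<close> cuts the finite index set of \<open>h\<close>.\<close>

lemma convolution_split:
  assumes h: "h \<in> steinberg G"
  shows "convolution G h f c = convolution G (\<lambda>a. h a * indicator B a) f c
    + convolution G (\<lambda>a. h a * indicator (arrows G - B) a) f c"
proof (cases "c \<in> arrows G")
  case True
  let ?S = "{b \<in> arrows G. rng G b = rng G c \<and> h b \<noteq> 0}"
  have *: "{b \<in> arrows G. rng G b = rng G c \<and> h b * indicator C b \<noteq> 0} = ?S \<inter> C"
    for C by (auto simp: indicator_def)
  have "convolution G (\<lambda>a. h a * indicator C a) f c
      = (\<Sum>b \<in> ?S \<inter> C. h b * f (comp G (ginv G b) c))" for C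
    unfolding convolution_def * using True by (auto intro!: sum.cong)
  moreover have "?S \<inter> (arrows G - B) = ?S - B"
    by auto
  ultimately show ?thesis
    using True sum.Int_Diff[OF finite_supp_fibre[OF h, of "rng G c"],
        of "\<lambda>b. h b * f (comp G (ginv G b) c)" B]
    by (simp add: convolution_def)
qed (simp add: convolution_def)

text \<open>Induction on the cover: the part of \<open>h\<close> on the clopen set \<open>B\<close>
  is handled by the case of one bisection, the rest is covered by the remaining bisections. The
  function \<open>h\<close> is generalised because the hypothesis is applied to that rest.\<close>

lemma locally_constant_convolution_cover:
  assumes "finite \<B>" "\<And>B. B \<in> \<B> \<Longrightarrow> compact_open_bisection G B"
    and "h \<in> steinberg G" "supp G h \<subseteq> \<Union>\<B>" "f \<in> steinberg G"
  shows "locally_constant G (convolution G h f)"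
  using assms
proof (induction \<B> arbitrary: h)
  case empty
  then have "convolution G h f c = 0" for c
    by (intro convolution_eq_zero) (auto simp: supp_def)
  then have "convolution G h f = (\<lambda>c. 0)"
    by auto
  then show ?case
    by (simp add: locally_constant_const)
next
  case (insert B \<B>)
  let ?h1 = "\<lambda>a. h a * indicator B a" and ?h2 = "\<lambda>a. h a * indicator (arrows G - B) a"
  have B: "compact_open_bisection G B" "openin (gtop G) B" "closedin (gtop G) B"
    using insert.prems(1)[of B] compactin_closedin
    by (auto simp: compact_open_bisection_def open_bisection_openin)
  then have B': "openin (gtop G) (arrows G - B)" "closedin (gtop G) (arrows G - B)"
    by (metis closedin_def topspace_gtop, metis closedin_diff closedin_topspace topspace_gtop B(2))
  have h1: "?h1 \<in> steinberg G" and h2: "?h2 \<in> steinberg G"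
    using B B' insert.prems(2) by (auto intro!: steinberg_times locally_constant_indicator)
  have "locally_constant G (convolution G ?h1 f)"
    using B h1 insert.prems(4) by (intro locally_constant_convolution_bisection[of B]) auto
  moreover have "locally_constant G (convolution G ?h2 f)"
    using insert.prems h2 by (intro insert.IH) (auto simp: supp_def indicator_def)
  ultimately have "locally_constant G (\<lambda>c. convolution G ?h1 f c + convolution G ?h2 f c)"
    by (rule locally_constant_binop)
  then show ?case
    unfolding convolution_split[OF insert.prems(2), of f _ B, symmetric] .
qed

text \<open>If the value at \<open>c\<close> is nonzero, some factorisation of \<open>c\<close> as
  \<open>b\<close> times \<open>comp G (ginv G b) c\<close> has its factors in the two supports. So
  the support lies in a compact set of products.\<close>

lemma steinberg_convolution:
  assumes h: "h \<in> steinberg G" and f: "f \<in> steinberg G"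
  shows "convolution G h f \<in> steinberg G"
proof (rule steinbergI)
  show "convolution G h f a = 0" if "a \<notin> arrows G" for a
    using that by (simp add: convolution_def)
  obtain \<B> where "finite \<B>" "\<And>B. B \<in> \<B> \<Longrightarrow> compact_open_bisection G B"
    "supp G h \<subseteq> \<Union>\<B>"
    using supp_cover[OF h] by metis
  then show "locally_constant G (convolution G h f)"
    using h f by (intro locally_constant_convolution_cover) auto
  show "compactin (gtop G) ((\<lambda>(a, b). comp G a b) ` (supp G h \<times> supp G f \<inter> composable G))"
    using h f by (intro compactin_comp_image steinbergD)
  show "supp G (convolution G h f) \<subseteq> (\<lambda>(a, b). comp G a b) ` (supp G h \<times> supp G f \<inter> composable G)"
  proof
    fix c assume "c \<in> supp G (convolution G h f)"
    then obtain b where b: "c \<in> arrows G" "b \<in> arrows G" "rng G b = rng G c" "h b \<noteq> 0"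
      "f (comp G (ginv G b) c) \<noteq> 0"
      unfolding supp_def by (auto elim!: convolution_nonzeroE)
    then show "c \<in> (\<lambda>(a, b). comp G a b) ` (supp G h \<times> supp G f \<inter> composable G)"
      by (intro image_eqI[of _ _ "(b, comp G (ginv G b) c)"]) (auto simp: supp_def composable_def)
  qed
qed

section \<open>Ideals of open invariant sets\<close>

lemma ideal_of_iff:
  "f \<in> ideal_of G U \<longleftrightarrow> f \<in> steinberg G \<and> (\<forall>a \<in> arrows G. f a \<noteq> 0 \<longrightarrow> src G a \<in> U)"
  by (auto simp: ideal_of_def supp_def arrows_restriction)

text \<open>In \<open>convolution G h f\<close> the argument of \<open>f\<close> has the same source
  as \<open>c\<close>. In \<open>convolution G f h\<close> the arrow \<open>b\<close> shares its
  range with \<open>c\<close>, and invariance carries membership in \<open>U\<close> from the source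
  of \<open>b\<close> through this range to the source of \<open>c\<close>.\<close>

lemma ideal_of_ideal:
  assumes U: "invariant G U"
  shows "ideal_of G U \<in> steinberg_ideals G"
proof -
  have "convolution G h f \<in> ideal_of G U" "convolution G f h \<in> ideal_of G U"
    if h: "h \<in> steinberg G" and f: "f \<in> ideal_of G U" for h f
  proof -
    have fU: "src G a \<in> U" if "a \<in> arrows G" "f a \<noteq> 0" for a
      using f that by (auto simp: ideal_of_iff)
    have fS: "f \<in> steinberg G"
      using f by (auto simp: ideal_of_iff)
    have "src G c \<in> U" if "convolution G h f c \<noteq> 0" for c
      using that
    proof (rule convolution_nonzeroE)
      fix b assume b: "c \<in> arrows G" "b \<in> arrows G" "rng G b = rng G c"
        "f (comp G (ginv G b) c) \<noteq> 0"
      then show ?thesis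
        using fU[of "comp G (ginv G b) c"] by simp
    qed
    then show "convolution G h f \<in> ideal_of G U"
      using steinberg_convolution[OF h fS] by (auto simp: ideal_of_iff)
    have "src G c \<in> U" if "convolution G f h c \<noteq> 0" for c
      using that
    proof (rule convolution_nonzeroE)
      fix b assume b: "c \<in> arrows G" "b \<in> arrows G" "rng G b = rng G c" "f b \<noteq> 0"
      then show ?thesis
        using fU[of b] invariant_iff[OF U, of b] invariant_iff[OF U, of c] by simp
    qed
    then show "convolution G f h \<in> ideal_of G U"
      using steinberg_convolution[OF fS h] by (auto simp: ideal_of_iff)
  qed
  moreover have "(\<lambda>a. f a + g a) \<in> ideal_of G U"
    if "f \<in> ideal_of G U" "g \<in> ideal_of G U" for f g
    using that steinberg_add unfolding ideal_of_iff by (metis add.right_neutral)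
  moreover have "(\<lambda>a. k * f a) \<in> ideal_of G U" if "f \<in> ideal_of G U" for k f
    using that steinberg_scale[of f G k] unfolding ideal_of_iff by auto
  moreover have "(\<lambda>a. 0) \<in> ideal_of G U" "ideal_of G U \<subseteq> steinberg G"
    using steinberg_zero by (auto simp: ideal_of_iff)
  ultimately show ?thesis
    unfolding steinberg_ideals_def by blast
qed

text \<open>The test functions are indicators of compact open \<open>B \<subseteq> U\<close>: a unit
  is its own source, so membership of such an indicator in \<open>ideal_of G V\<close> forces
  \<open>B \<subseteq> V\<close>.\<close>

lemma ideal_of_subset_iff:
  assumes U: "U \<in> open_invariants G"
  shows "(ideal_of G U :: ('a \<Rightarrow> 'f::field) set) \<subseteq> ideal_of G V \<longleftrightarrow> U \<subseteq> V"
proof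
  assume sub: "(ideal_of G U :: ('a \<Rightarrow> 'f) set) \<subseteq> ideal_of G V"
  show "U \<subseteq> V"
  proof
    fix u assume u: "u \<in> U"
    have oU: "openin (gtop G) U" "U \<subseteq> units G"
      using U by (auto simp: open_invariants_def openin_unit_top_iff)
    then obtain B where B: "compact_open_bisection G B" "u \<in> B" "B \<subseteq> U"
      using compact_open_bisection_at u by metis
    then have "(indicator B :: 'a \<Rightarrow> 'f) \<in> steinberg G"
      by (intro indicator_steinberg) (auto simp: compact_open_bisection_def open_bisection_openin)
    then have "(indicator B :: 'a \<Rightarrow> 'f) \<in> ideal_of G U"
      unfolding ideal_of_iff using B(3) oU(2) by (auto simp: indicator_def subset_iff)
    then have "(indicator B :: 'a \<Rightarrow> 'f) \<in> ideal_of G V"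
      using sub by blast
    then show "u \<in> V"
      unfolding ideal_of_iff using B(2) u oU(2)
      by (metis indicator_simps(1) src_of_unit subsetD unit_arrow zero_neq_one)
  qed
qed (auto simp: ideal_of_def arrows_restriction)

lemma ideal_of_Int: "ideal_of G (U \<inter> V) = ideal_of G U \<inter> ideal_of G V"
  by (auto simp: ideal_of_iff)

text \<open>The support is covered by compact open bisections, each with all its sources in
  \<open>U\<close> or all in \<open>V\<close>. The union \<open>K\<close> of those of the first kind
  is clopen, and truncating \<open>f\<close> to \<open>K\<close> and to its complement gives the two
  summands.\<close>

lemma ideal_of_Un:
  assumes U: "U \<in> open_invariants G" and V: "V \<in> open_invariants G"
  shows "ideal_of G (U \<union> V) = ideal_sum (ideal_of G U) (ideal_of G V :: ('a \<Rightarrow> 'f::field) set)"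
proof (intro equalityI subsetI)
  fix f :: "'a \<Rightarrow> 'f"
  assume f: "f \<in> ideal_of G (U \<union> V)"
  let ?P = "\<lambda>X B. B \<subseteq> {a \<in> arrows G. src G a \<in> X}"
  have fS: "f \<in> steinberg G"
    using f by (simp add: ideal_of_iff)
  have "\<exists>B. compact_open_bisection G B \<and> a \<in> B \<and> (?P U B \<or> ?P V B)" if "a \<in> supp G f" for a
  proof -
    have a: "a \<in> arrows G" "src G a \<in> U \<union> V"
      using that f by (auto simp: supp_def ideal_of_iff)
    have "\<exists>B. compact_open_bisection G B \<and> a \<in> B \<and> ?P X B"
      if "X \<in> open_invariants G" "src G a \<in> X" for X
    proof -
      have "openin (gtop G) {a \<in> arrows G. src G a \<in> X}"
        using that by (intro openin_src_vimage) (auto simp: open_invariants_def openin_unit_top_iff)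
      then show ?thesis
        using compact_open_bisection_at[of _ a] a that by (metis (mono_tags, lifting) mem_Collect_eq)
    qed
    then show ?thesis
      using a U V by blast
  qed
  with steinbergD(3)[OF fS] have "\<exists>\<B>. finite \<B> \<and>
      (\<forall>B \<in> \<B>. compact_open_bisection G B \<and> (?P U B \<or> ?P V B)) \<and> supp G f \<subseteq> \<Union>\<B>"
    by (rule compact_open_bisection_cover)
  then obtain \<B> where \<B>: "finite \<B>" "\<forall>B \<in> \<B>. compact_open_bisection G B \<and> (?P U B \<or> ?P V B)"
    "supp G f \<subseteq> \<Union>\<B>"
    by (elim exE conjE)
  define K where "K = \<Union>{B \<in> \<B>. ?P U B}"
  have K: "openin (gtop G) K" "compactin (gtop G) K"
    unfolding K_def using \<B>
    by (auto intro!: openin_Union compactin_Union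
        simp: compact_open_bisection_def open_bisection_openin)
  then have K': "openin (gtop G) (arrows G - K)" "closedin (gtop G) K"
    "closedin (gtop G) (arrows G - K)"
    using compactin_closedin[OF K(2)]
    by (auto simp: closedin_def openin_arrows double_diff)
  have "(\<lambda>a. f a * indicator K a) \<in> ideal_of G U"
    unfolding ideal_of_iff using fS K K'
    by (auto intro!: steinberg_times locally_constant_indicator) (auto simp: indicator_def K_def)
  moreover have "(\<lambda>a. f a * indicator (arrows G - K) a) \<in> ideal_of G V"
    unfolding ideal_of_iff
  proof (intro conjI ballI impI)
    show "(\<lambda>a. f a * indicator (arrows G - K) a) \<in> steinberg G"
      using fS K' by (auto intro!: steinberg_times locally_constant_indicator)
    fix a assume "a \<in> arrows G" "f a * indicator (arrows G - K) a \<noteq> 0"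
    then have "a \<in> supp G f" "a \<notin> K"
      by (auto simp: supp_def indicator_def split: if_splits)
    then obtain B where B: "B \<in> \<B>" "a \<in> B"
      using \<B>(3) by blast
    with \<open>a \<notin> K\<close> have "\<not> ?P U B"
      unfolding K_def by blast
    then have "?P V B"
      using \<B>(2) B(1) by metis
    then show "src G a \<in> V"
      using B(2) by blast
  qed
  moreover have "f = (\<lambda>a. f a * indicator K a + f a * indicator (arrows G - K) a)"
    using steinbergD(1)[OF fS] by (intro ext) (auto simp: indicator_def)
  ultimately show "f \<in> ideal_sum (ideal_of G U) (ideal_of G V)"
    unfolding ideal_sum_def mem_Collect_eq by (intro exI conjI)
next
  fix f :: "'a \<Rightarrow> 'f"
  assume "f \<in> ideal_sum (ideal_of G U) (ideal_of G V)"
  then obtain g h where gh: "f = (\<lambda>a. g a + h a)" "g \<in> ideal_of G U" "h \<in> ideal_of G V"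
    by (auto simp: ideal_sum_def)
  then show "f \<in> ideal_of G (U \<union> V)"
    using steinberg_add[of g G h] unfolding ideal_of_iff by (metis UnCI add.right_neutral)
qed

end

section \<open>Recovering the open invariant set of an ideal\<close>

definition ideal_units :: "'a top_groupoid \<Rightarrow> ('a \<Rightarrow> 'f::field) set \<Rightarrow> 'a set" where
  "ideal_units G I = \<Union>{K. openin (gtop G) K \<and> compactin (gtop G) K \<and> K \<subseteq> units G \<and> indicator K \<in> I}"

lemma steinberg_idealsD:
  assumes "I \<in> steinberg_ideals G"
  shows "I \<subseteq> steinberg G" "(\<lambda>a. 0) \<in> I"
    "\<lbrakk>f \<in> I; g \<in> I\<rbrakk> \<Longrightarrow> (\<lambda>a. f a + g a) \<in> I"
    "f \<in> I \<Longrightarrow> (\<lambda>a. k * f a) \<in> I"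
    "\<lbrakk>h \<in> steinberg G; f \<in> I\<rbrakk> \<Longrightarrow> convolution G h f \<in> I"
    "\<lbrakk>h \<in> steinberg G; f \<in> I\<rbrakk> \<Longrightarrow> convolution G f h \<in> I"
  using assms by (auto simp: steinberg_ideals_def)

context hausdorff_ample_groupoid
begin

lemma ideal_units_open_invariant:
  assumes I: "I \<in> steinberg_ideals G"
  shows "ideal_units G I \<in> open_invariants G"
proof -
  have "openin (gtop G) (ideal_units G I)" "ideal_units G I \<subseteq> units G"
    by (auto simp: ideal_units_def intro: openin_Union)
  moreover have "rng G a \<in> ideal_units G I" if a: "a \<in> arrows G" "src G a \<in> ideal_units G I" for a
  proof -
    obtain K where K: "openin (gtop G) K" "K \<subseteq> units G" "indicator K \<in> I" "src G a \<in> K"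
      using a by (auto simp: ideal_units_def)
    obtain B where B: "compact_open_bisection G B" "a \<in> B" "B \<subseteq> {b \<in> arrows G. src G b \<in> K}"
      using compact_open_bisection_at[OF openin_src_vimage[OF K(1)], of a] a K by auto
    have Bo: "openin (gtop G) B" "compactin (gtop G) B"
      and inj: "inj_on (rng G) B" "inj_on (src G) B"
      using B(1) open_bisection_openin open_bisection_inj_on
      unfolding compact_open_bisection_def by blast+
    let ?C = "convolution G (convolution G (indicator B) (indicator K)) (indicator (ginv G ` B))"
    have Ba: "B \<subseteq> arrows G"
      using B by auto
    have 1: "convolution G (indicator B) (indicator K) = indicator B"
    proof
      fix c
      show "convolution G (indicator B) (indicator K) c = indicator B c"
      proof (cases "c \<in> arrows G")
        case True
        then show ?thesis
          using convolution_indicator_right[OF indicator_steinberg[OF Bo] K(2) True] B(3)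
          by (auto simp: indicator_def)
      qed (use Ba in \<open>auto simp: convolution_def indicator_def\<close>)
    qed
    have 2: "convolution G (indicator B) (indicator (ginv G ` B)) = indicator (rng G ` B)"
    proof
      fix c
      show "convolution G (indicator B) (indicator (ginv G ` B)) c = indicator (rng G ` B) c"
      proof (cases "c \<in> arrows G \<and> rng G c \<in> rng G ` B")
        case True
        then obtain b where b: "b \<in> B" "rng G b = rng G c" "b \<in> arrows G" and c: "c \<in> arrows G"
          using Ba by auto
        \<comment> \<open>If the product is the inverse of some \<open>d\<close> in
          \<open>B\<close>, then \<open>d\<close> and \<open>b\<close> have the same source, so
          \<open>d = b\<close> by injectivity and \<open>c\<close> is the unit
          \<open>rng G b\<close>.\<close>
        have "comp G (ginv G b) c \<in> ginv G ` B \<longleftrightarrow> c \<in> rng G ` B"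
        proof
          assume "comp G (ginv G b) c \<in> ginv G ` B"
          then obtain d where d: "d \<in> B" "comp G (ginv G b) c = ginv G d" "d \<in> arrows G"
            using Ba by auto
          have "rng G (comp G (ginv G b) c) = src G b"
            using b c by simp
          then have "src G d = src G b"
            using d by simp
          then have "d = b"
            using inj(2) d(1) b(1) by (auto dest: inj_onD)
          then have "c = comp G b (ginv G b)"
            using d(2) comp_ginv_cancel[OF b(3) c b(2)] by simp
          then have "c = rng G b"
            using b(3) by simp
          then show "c \<in> rng G ` B"
            using b(1) by blast
        next
          assume "c \<in> rng G ` B"
          then have "c = rng G c"
            using Ba by auto
          then have "c = rng G b"
            using b by simp
          then have "comp G (ginv G b) c = ginv G b"
            using src_right_unit[of "ginv G b"] b by simp
          then show "comp G (ginv G b) c \<in> ginv G ` B"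
            using b by simp
        qed
        moreover have "convolution G (indicator B) (indicator (ginv G ` B)) c
            = indicator B b * indicator (ginv G ` B) (comp G (ginv G b) c)"
          using b c by (intro convolution_inj_on[OF inj(1)]) auto
        ultimately show ?thesis
          using b by (auto simp: indicator_def)
      next
        case False
        have "b \<notin> B" if "c \<in> arrows G" "rng G b = rng G c" for b
          using False that by (metis imageI)
        then have "convolution G (indicator B) (indicator (ginv G ` B)) c = 0"
          by (cases "c \<in> arrows G") (auto simp: convolution_def intro!: convolution_eq_zero)
        moreover have "c \<notin> rng G ` B"
          using False Ba by (auto simp: subset_iff)
        ultimately show ?thesis
          by simp
      qed
    qed
    have "?C \<in> I"
      using Bo K(3)
      by (intro steinberg_idealsD(5,6)[OF I] indicator_steinberg openin_ginv_image
          compactin_ginv_image)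
    then have "indicator (rng G ` B) \<in> I"
      unfolding 1 2 .
    moreover have "openin (gtop G) (rng G ` B)" "compactin (gtop G) (rng G ` B)"
      using Bo by (auto intro: openin_image image_compactin continuous_rng)
    moreover have "rng G ` B \<subseteq> units G"
      using Ba by auto
    ultimately show ?thesis
      using B(2) unfolding ideal_units_def by blast
  qed
  ultimately show ?thesis
    by (auto simp: open_invariants_def openin_unit_top_iff invariant_def)
qed

text \<open>Inclusion-exclusion, with the indicator of the intersection obtained as the convolution
  of the two indicators.\<close>

lemma indicator_Un_ideal:
  fixes I :: "('a \<Rightarrow> 'f::field) set"
  assumes I: "I \<in> steinberg_ideals G"
    and K: "K \<subseteq> units G" "indicator K \<in> I" and L: "L \<subseteq> units G" "indicator L \<in> I"
  shows "indicator (K \<union> L) \<in> I"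
proof -
  have "(indicator K :: 'a \<Rightarrow> 'f) \<in> steinberg G"
    using K steinberg_idealsD(1)[OF I] by auto
  then have "convolution G (indicator K :: 'a \<Rightarrow> 'f) (indicator L) \<in> I"
    using L by (intro steinberg_idealsD(5)[OF I])
  also have "convolution G (indicator K :: 'a \<Rightarrow> 'f) (indicator L) = indicator (K \<inter> L)"
  proof
    fix c
    show "convolution G (indicator K :: 'a \<Rightarrow> 'f) (indicator L) c = indicator (K \<inter> L) c"
    proof (cases "c \<in> arrows G")
      case True
      then show ?thesis
        using convolution_indicator_left[OF K(1) True, of "indicator L :: 'a \<Rightarrow> 'f"] L(1)
        by (auto simp: indicator_def)
    next
      case False
      then have "c \<notin> K"
        using K(1) by auto
      with False show ?thesis
        by (simp add: convolution_def)
    qed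
  qed
  finally have "(\<lambda>a. (indicator K a + indicator L a) + - 1 * indicator (K \<inter> L) a) \<in> I"
    using K L by (intro steinberg_idealsD(3,4)[OF I])
  also have "(\<lambda>a. (indicator K a + indicator L a) + - 1 * indicator (K \<inter> L) a)
      = (indicator (K \<union> L) :: 'a \<Rightarrow> 'f)"
    by (auto simp: indicator_def)
  finally show ?thesis .
qed

lemma indicator_Union_ideal:
  fixes I :: "('a \<Rightarrow> 'f::field) set"
  assumes I: "I \<in> steinberg_ideals G"
    and "finite \<K>" "\<And>K. K \<in> \<K> \<Longrightarrow> K \<subseteq> units G \<and> indicator K \<in> I"
  shows "indicator (\<Union>\<K>) \<in> I"
  using assms(2,3)
proof (induction \<K>)
  case empty
  have "indicator {} = (\<lambda>a. 0 :: 'f)"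
    by auto
  then show ?case
    using steinberg_idealsD(2)[OF I] by simp
next
  case (insert K \<K>)
  then show ?case
    using indicator_Un_ideal[OF I, of K "\<Union>\<K>"] by (simp add: Sup_le_iff)
qed

text \<open>The sources of the support form a compact set, so finitely many of the sets
  \<open>K\<close> cover them, and the indicator of their union is a right unit for
  \<open>f\<close>.\<close>

lemma ideal_of_ideal_units_subset:
  fixes I :: "('a \<Rightarrow> 'f::field) set"
  assumes I: "I \<in> steinberg_ideals G"
  shows "ideal_of G (ideal_units G I) \<subseteq> I"
proof
  fix f :: "'a \<Rightarrow> 'f"
  assume "f \<in> ideal_of G (ideal_units G I)"
  then have f: "f \<in> steinberg G" "\<And>a. \<lbrakk>a \<in> arrows G; f a \<noteq> 0\<rbrakk> \<Longrightarrow> src G a \<in> ideal_units G I"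
    by (auto simp: ideal_of_iff)
  let ?C = "{K. openin (gtop G) K \<and> compactin (gtop G) K \<and> K \<subseteq> units G \<and> indicator K \<in> I}"
  have "\<exists>\<K>. finite \<K> \<and> \<K> \<subseteq> ?C \<and> src G ` supp G f \<subseteq> \<Union>\<K>"
  proof (rule compactinD)
    show "compactin (gtop G) (src G ` supp G f)"
      using image_compactin[OF steinbergD(3)[OF f(1)] continuous_src] .
    show "src G ` supp G f \<subseteq> \<Union>?C"
      using f(2) by (auto simp: supp_def ideal_units_def)
  qed simp
  then obtain \<K> where \<K>: "finite \<K>" "\<K> \<subseteq> ?C" "src G ` supp G f \<subseteq> \<Union>\<K>"
    by (elim exE conjE)
  have "(indicator (\<Union>\<K>) :: 'a \<Rightarrow> 'f) \<in> I"
    using \<K> by (intro indicator_Union_ideal[OF I]) auto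
  then have "convolution G f (indicator (\<Union>\<K>)) \<in> I"
    using f(1) by (intro steinberg_idealsD(5)[OF I])
  also have "convolution G f (indicator (\<Union>\<K>)) = f"
  proof
    fix c
    show "convolution G f (indicator (\<Union>\<K>)) c = f c"
    proof (cases "c \<in> arrows G")
      case True
      have "\<Union>\<K> \<subseteq> units G"
        using \<K>(2) by blast
      moreover have "src G c \<in> \<Union>\<K>" if "f c \<noteq> 0"
        using \<K>(3) that True by (auto simp: supp_def)
      ultimately show ?thesis
        using convolution_indicator_right[OF f(1) _ True] by (auto simp: indicator_def)
    next
      case False
      then show ?thesis
        using steinbergD(1)[OF f(1)] by (simp add: convolution_def)
    qed
  qed
  finally show "f \<in> I" .
qed

section \<open>Shrinking open sets by effectiveness\<close>

text \<open>Either some arrow of \<open>B\<close> over \<open>W \<inter> V\<close> has distinct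
  ends, which can be separated, or all such arrows are isotropy. In the second case they form an
  open set of isotropy in the restriction, so they are units by effectiveness; as \<open>B\<close>
  contains no units there are none, and \<open>W\<close> itself works.\<close>

lemma effective_shrink_bisection:
  assumes V: "invariant G V" "effective (restriction G V)"
    and B: "open_bisection G B" "B \<inter> units G = {}"
    and W: "openin (gtop G) W" "W \<inter> V \<noteq> {}"
  obtains W' where "openin (gtop G) W'" "W' \<subseteq> W" "W' \<inter> V \<noteq> {}"
    "\<And>b. \<lbrakk>b \<in> B; src G b \<in> W' \<inter> V\<rbrakk> \<Longrightarrow> rng G b \<notin> W'"
proof (cases "\<exists>b \<in> B. src G b \<in> W \<inter> V \<and> rng G b \<noteq> src G b")
  case True
  then obtain b where b: "b \<in> B" "src G b \<in> W \<inter> V" "rng G b \<noteq> src G b" "b \<in> arrows G"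
    using open_bisection_arrows[OF B(1)] by auto
  then obtain P Q where PQ: "openin (gtop G) P" "openin (gtop G) Q" "rng G b \<in> P" "src G b \<in> Q"
    "disjnt P Q"
    using hausdorff unfolding Hausdorff_space_def
    by (metis rng_unit src_unit topspace_gtop unit_arrow)
  \<comment> \<open>These arrows of \<open>B\<close> go from \<open>Q\<close> to \<open>P\<close>.
    Injectivity of \<open>src G\<close> makes any arrow of \<open>B\<close> with source in
    \<open>src G\<close>
    ?B\<open>one of them, so its range avoids\<close>Q\<open>and hence\<close>src G
    \<open>?B\<close>.\<close>
  let ?B = "B \<inter> {a \<in> arrows G. rng G a \<in> P} \<inter> {a \<in> arrows G. src G a \<in> Q}"
  show ?thesis
  proof (rule that[of "W \<inter> src G ` ?B"])
    show "openin (gtop G) (W \<inter> src G ` ?B)"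
      using W(1) PQ open_bisection_openin[OF B(1)]
      by (intro openin_Int openin_image openin_rng_vimage openin_src_vimage) auto
    show "W \<inter> src G ` ?B \<inter> V \<noteq> {}"
      using b PQ by blast
    fix d assume d: "d \<in> B" "src G d \<in> W \<inter> src G ` ?B \<inter> V"
    then obtain b' where b': "b' \<in> ?B" "src G d = src G b'"
      by auto
    then have "d = b'"
      using d(1) open_bisection_inj_on(2)[OF B(1)] by (auto dest: inj_onD)
    then have "rng G d \<in> P"
      using b' by auto
    moreover have "src G ` ?B \<subseteq> Q"
      by auto
    ultimately show "rng G d \<notin> W \<inter> src G ` ?B"
      using PQ(5) by (auto simp: disjnt_iff)
  qed auto
next
  case False
  let ?R = "restriction G V"
  let ?N = "{a \<in> arrows G. src G a \<in> V} \<inter> (B \<inter> {a \<in> arrows G. src G a \<in> W})"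
  have "openin (gtop G) (B \<inter> {a \<in> arrows G. src G a \<in> W})"
    using open_bisection_openin[OF B(1)] W(1) by (intro openin_Int openin_src_vimage)
  then have "openin (gtop ?R) ?N"
    by (auto simp: restriction_def intro: openin_subtopology_Int2)
  moreover have "?N \<subseteq> isotropy ?R"
    using False by (auto simp: isotropy_def arrows_restriction) (auto simp: restriction_def)
  ultimately have "?N \<subseteq> gtop ?R interior_of isotropy ?R"
    by (simp add: interior_of_maximal)
  also have "\<dots> = V"
    using V by (simp add: effective_def units_restriction)
  finally have "?N \<subseteq> units G"
    using V(1) by (auto simp: invariant_def)
  then have "?N = {}"
    using B(2) by blast
  then show ?thesis
    using W open_bisection_arrows[OF B(1)] by (intro that[of W]) auto
qed

text \<open>Shrinking for one bisection at a time suffices, since the avoidance property passes to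
  smaller sets.\<close>

lemma effective_shrink_bisections:
  assumes V: "invariant G V" "effective (restriction G V)"
    and "finite \<B>" "\<And>B. B \<in> \<B> \<Longrightarrow> open_bisection G B \<and> B \<inter> units G = {}"
    and W: "openin (gtop G) W" "W \<inter> V \<noteq> {}"
  shows "\<exists>W'. openin (gtop G) W' \<and> W' \<subseteq> W \<and> W' \<inter> V \<noteq> {} \<and>
    (\<forall>b \<in> \<Union>\<B>. src G b \<in> W' \<inter> V \<longrightarrow> rng G b \<notin> W')"
  using assms(3,4)
proof (induction \<B>)
  case empty
  then show ?case
    using W by auto
next
  case (insert B \<B>)
  then obtain W1 where W1: "openin (gtop G) W1" "W1 \<subseteq> W" "W1 \<inter> V \<noteq> {}"
    "\<forall>b \<in> \<Union>\<B>. src G b \<in> W1 \<inter> V \<longrightarrow> rng G b \<notin> W1"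
    by (metis insertI2)
  obtain W2 where "openin (gtop G) W2" "W2 \<subseteq> W1" "W2 \<inter> V \<noteq> {}"
    "\<And>b. \<lbrakk>b \<in> B; src G b \<in> W2 \<inter> V\<rbrakk> \<Longrightarrow> rng G b \<notin> W2"
    using effective_shrink_bisection[OF V _ _ W1(1,3), of B] insert.prems by blast
  then show ?case
    using W1 by (intro exI[of _ W2]) blast
qed

text \<open>Left multiplication by the indicator of the inverse of a bisection around
  \<open>a\<close> moves the value \<open>f a\<close> to the unit \<open>src G a\<close>.\<close>

lemma ideal_unit_value:
  fixes I :: "('a \<Rightarrow> 'f::field) set"
  assumes I: "I \<in> steinberg_ideals G" and f: "f \<in> I" and a: "a \<in> arrows G" "f a \<noteq> 0"
  obtains g where "g \<in> I" "g (src G a) \<noteq> 0"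
proof -
  obtain B where B: "compact_open_bisection G B" "a \<in> B"
    using compact_open_bisection_at[of "arrows G" a] a(1) by (metis openin_topspace topspace_gtop)
  have Bo: "openin (gtop G) B" "compactin (gtop G) B" "inj_on (src G) B" "B \<subseteq> arrows G"
    using B(1) open_bisection_openin open_bisection_inj_on open_bisection_arrows
    unfolding compact_open_bisection_def by blast+
  have inj: "inj_on (rng G) (ginv G ` B)"
    using Bo(3,4) by (auto simp: inj_on_def subset_iff)
  have "convolution G (indicator (ginv G ` B)) f (src G a)
      = indicator (ginv G ` B) (ginv G a) * f (comp G (ginv G (ginv G a)) (src G a))"
    using B a by (intro convolution_inj_on[OF inj]) auto
  then have "convolution G (indicator (ginv G ` B)) f (src G a) \<noteq> 0"
    using B a by simp
  moreover have "convolution G (indicator (ginv G ` B)) f \<in> I"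
    using Bo f by (intro steinberg_idealsD(5)[OF I] indicator_steinberg openin_ginv_image
        compactin_ginv_image)
  ultimately show ?thesis
    using that by blast
qed

lemma ideal_subset_ideal_of_ideal_units:
  fixes I :: "('a \<Rightarrow> 'f::field) set"
  assumes I: "I \<in> steinberg_ideals G" and eff: "strongly_effective G"
  shows "I \<subseteq> ideal_of G (ideal_units G I)"
proof
  fix f assume f: "f \<in> I"
  define U where "U = ideal_units G I"
  define V where "V = units G - U"
  have U: "openin (gtop G) U" "U \<subseteq> units G" "invariant G U"
    using ideal_units_open_invariant[OF I]
    by (auto simp: U_def open_invariants_def openin_unit_top_iff)
  have "topspace (unit_top G) = units G" "units G - V = U"
    using U(2) by (auto simp: unit_top_def V_def)
  then have V: "invariant G V" "closedin (unit_top G) V"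
    using U invariant_Diff[OF U(3)] by (auto simp: V_def closedin_def openin_unit_top_iff)
  have "src G a \<in> U" if a: "a \<in> arrows G" "f a \<noteq> 0" for a
  proof (rule ccontr)
    assume "src G a \<notin> U"
    then have aV: "src G a \<in> V"
      using a by (simp add: V_def)
    \<comment> \<open>The unit \<open>src G a\<close> shows that \<open>V\<close> is nonempty, as
      strong effectiveness requires.\<close>
    then have effV: "effective (restriction G V)"
      using eff V unfolding strongly_effective_def by blast
    obtain g where g: "g \<in> I" "g (src G a) \<noteq> 0"
      using ideal_unit_value[OF I f a] .
    define k where "k = g (src G a)"
    have gS: "g \<in> steinberg G"
      using g(1) steinberg_idealsD(1)[OF I] by blast
    obtain N where N: "openin (gtop G) N" "src G a \<in> N" "\<forall>x \<in> N. g x = k"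
      using steinbergD(2)[OF gS] a unfolding locally_constant_def k_def
      by (metis src_unit unit_arrow)
    have oc: "openin (gtop G) (arrows G - units G)"
      using closedin_units by (simp add: closedin_def)
    have "supp G g - units G = supp G g \<inter> (arrows G - units G)"
      by (auto simp: supp_def)
    moreover have "closedin (gtop G) (arrows G - units G)"
      using closedin_diff[OF closedin_topspace openin_units] by simp
    \<comment> \<open>Openness of the units makes the non-unit part of the support compact, so
      finitely many bisections that miss the units carry it.\<close>
    ultimately have "compactin (gtop G) (supp G g - units G)"
      using steinbergD(3)[OF gS] by (simp add: compact_Int_closedin)
    moreover have "\<exists>B. compact_open_bisection G B \<and> b \<in> B \<and> B \<inter> units G = {}"
      if "b \<in> supp G g - units G" for b
    proof -
      have "b \<in> arrows G - units G"
        using that by (auto simp: supp_def)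
      then obtain B where "compact_open_bisection G B" "b \<in> B" "B \<subseteq> arrows G - units G"
        using compact_open_bisection_at[OF oc] by metis
      then show ?thesis
        by blast
    qed
    ultimately have "\<exists>\<B>. finite \<B> \<and>
        (\<forall>B \<in> \<B>. compact_open_bisection G B \<and> B \<inter> units G = {}) \<and> supp G g - units G \<subseteq> \<Union>\<B>"
      by (rule compact_open_bisection_cover)
    then obtain \<B> where \<B>: "finite \<B>"
      "\<forall>B \<in> \<B>. compact_open_bisection G B \<and> B \<inter> units G = {}" "supp G g - units G \<subseteq> \<Union>\<B>"
      by (elim exE conjE)
    \<comment> \<open>Shrinking starts from units on which \<open>g\<close> has the constant value
      \<open>k\<close>.\<close>
    have "openin (gtop G) (N \<inter> units G)" "N \<inter> units G \<inter> V \<noteq> {}"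
      using N aV a openin_units by auto
    then obtain W where W: "openin (gtop G) W" "W \<subseteq> N \<inter> units G" "W \<inter> V \<noteq> {}"
      "\<forall>b \<in> \<Union>\<B>. src G b \<in> W \<inter> V \<longrightarrow> rng G b \<notin> W"
      using effective_shrink_bisections[OF V(1) effV \<B>(1), of "N \<inter> units G"] \<B>(2)
      unfolding compact_open_bisection_def by blast
    then obtain w where w: "w \<in> W" "w \<in> V"
      by blast
    then obtain K where K: "compact_open_bisection G K" "w \<in> K" "K \<subseteq> W"
      using compact_open_bisection_at W(1) by metis
    have Ko: "openin (gtop G) K" "compactin (gtop G) K" "K \<subseteq> units G"
      using K W(2) by (auto simp: compact_open_bisection_def open_bisection_openin)
    let ?\<chi> = "indicator K :: 'a \<Rightarrow> 'f"
    \<comment> \<open>Compression of \<open>g\<close> to the arrows with both ends in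
      \<open>K\<close>.\<close>
    let ?g = "convolution G (convolution G ?\<chi> g) ?\<chi>"
    have K1: "?\<chi> \<in> steinberg G"
      using Ko by (intro indicator_steinberg)
    have gI: "?g \<in> I"
      using K1 g(1) by (intro steinberg_idealsD(5,6)[OF I])
    have geq: "?g c = ?\<chi> (rng G c) * g c * ?\<chi> (src G c)" if "c \<in> arrows G" for c
      using that Ko(3) K1 gS
      by (simp add: convolution_indicator_right convolution_indicator_left steinberg_convolution)
    \<comment> \<open>The error term vanishes over \<open>V\<close>: at units because
      \<open>g\<close> equals \<open>k\<close> on \<open>K\<close>, at other arrows because none in
      the cover with source in \<open>W \<inter> V\<close> has its range in
      \<open>W\<close>.\<close>
    let ?e = "\<lambda>c. ?g c + - k * ?\<chi> c"
    have "src G c \<in> U" if c: "c \<in> arrows G" "?e c \<noteq> 0" for c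
    proof (rule ccontr)
      assume "src G c \<notin> U"
      then have cV: "src G c \<in> V"
        using c(1) by (simp add: V_def)
      show False
      proof (cases "c \<in> units G")
        case True
        then show False
          using c geq[OF c(1)] N(3) W(2) K(3) by (auto simp: indicator_def split: if_splits)
      next
        case False
        then have "?\<chi> c = 0"
          using Ko(3) by (auto simp: indicator_def)
        then have "rng G c \<in> K" "src G c \<in> K" "g c \<noteq> 0"
          using c geq[OF c(1)] by (auto simp: indicator_def split: if_splits)
        moreover from this have "c \<in> \<Union>\<B>"
          using \<B>(3) False c(1) by (auto simp: supp_def)
        ultimately show False
          using W(4) K(3) cV by blast
      qed
    qed
    moreover have "?e \<in> steinberg G"
      using gI K1 steinberg_idealsD(1)[OF I] by (intro steinberg_add steinberg_scale) auto
    ultimately have "?e \<in> ideal_of G U"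
      by (simp add: ideal_of_iff)
    then have "?e \<in> I"
      using ideal_of_ideal_units_subset[OF I] by (auto simp: U_def)
    then have "(\<lambda>c. - 1 * ?e c) \<in> I"
      by (rule steinberg_idealsD(4)[OF I])
    with gI have "(\<lambda>c. ?g c + - 1 * ?e c) \<in> I"
      by (rule steinberg_idealsD(3)[OF I])
    \<comment> \<open>Both the compression and the error lie in \<open>I\<close>; their difference
      is \<open>k\<close> times \<open>indicator K\<close>, and \<open>k\<close> is nonzero.\<close>
    then have "(\<lambda>c. inverse k * (?g c + - 1 * ?e c)) \<in> I"
      by (rule steinberg_idealsD(4)[OF I])
    also have "(\<lambda>c. inverse k * (?g c + - 1 * ?e c)) = ?\<chi>"
      using g(2) by (auto simp: k_def field_simps)
    finally have "K \<subseteq> U"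
      using Ko unfolding U_def ideal_units_def by blast
    then show False
      using w K by (auto simp: V_def)
  qed
  then show "f \<in> ideal_of G (ideal_units G I)"
    using f steinberg_idealsD(1)[OF I] by (auto simp: ideal_of_iff U_def)
qed

end

theorem corollary3p7:
  fixes G :: "'a top_groupoid"
  assumes "ample_groupoid G"
    and "Hausdorff_space (gtop G)"
    and "strongly_effective G"
  shows "lattice_isomorphism (ideal_of G :: 'a set \<Rightarrow> ('a \<Rightarrow> 'f::field) set)
           (open_invariants G) (\<union>) (\<inter>)
           (steinberg_ideals G) ideal_sum (\<inter>)"
proof -
  interpret hausdorff_ample_groupoid G
    using assms by (simp add: hausdorff_ample_groupoid_def hausdorff_ample_groupoid_axioms_def)
  let ?I = "ideal_of G :: 'a set \<Rightarrow> ('a \<Rightarrow> 'f) set"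
  have "inj_on ?I (open_invariants G)"
    by (rule inj_onI) (metis equalityI ideal_of_subset_iff order_refl)
  moreover have "?I U \<in> steinberg_ideals G" if "U \<in> open_invariants G" for U
    using that by (auto simp: open_invariants_def intro: ideal_of_ideal)
  \<comment> \<open>Surjectivity: the preimage of \<open>I\<close> is
    \<open>ideal_units G I\<close>.\<close>
  moreover have "I \<in> ?I ` open_invariants G" if "I \<in> steinberg_ideals G" for I
    using that ideal_units_open_invariant ideal_of_ideal_units_subset
      ideal_subset_ideal_of_ideal_units assms(3)
    by (metis equalityI image_eqI)
  ultimately have "bij_betw ?I (open_invariants G) (steinberg_ideals G)"
    unfolding bij_betw_def by blast
  then show ?thesis
    unfolding lattice_isomorphism_def
    by (simp add: ideal_of_subset_iff ideal_of_Un ideal_of_Int)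
qed

end
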